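(* For every integer $d\ge1$ and every subdivision $B^*$ of the complete binary tree $B_d$, $\mathrm{ODD}(B^* )\ge\sqrt d$.
   Context: $B_d$ is the rooted complete binary tree with $d$ levels ($2^d-1$ vertices). A graph $H$ is a subdivision of $G$ if $H$ is obtained by replacing every edge of $G$ by a path. For a graph $G$, an odd coloring w.r.t. paths is a function $C\colon V(G)\to\{1,\dots,k\}$ such that for the vertex set of every path of $G$ (including single vertices) some color occurs an odd number of times on it; $\mathrm{ODD}(G)$ is the minimum such $k$. *)

theory Defs
  imports
    Complex_Main
    "Graph_Theory.Subdivision"
    "Graph_Theory.Vertex_Walk"
    "Graph_Theory.Digraph_Isomorphism"
begin

(* Undirected graphs are symmetric loop-free digraphs, as in Graph_Theory. A vertex of the tree
   is the sequence of left/right turns leading from it back to the root []; its parent is its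
   tail. Each edge contributes both of its orientations. *)
definition complete_binary_tree :: "nat \<Rightarrow> bool list pair_pre_digraph" where
  "complete_binary_tree d =
     \<lparr> pverts = {xs. length xs < d},
       parcs = {(xs, b # xs) | xs b. length (b # xs) < d}
             \<union> {(b # xs, xs) | xs b. length (b # xs) < d} \<rparr>"

(* A vpath is a nonempty repetition-free vertex sequence with consecutive vertices adjacent,
   so single vertices are included. *)
definition odd_path_coloring :: "('a, 'b) pre_digraph \<Rightarrow> nat \<Rightarrow> ('a \<Rightarrow> nat) \<Rightarrow> bool" where
  "odd_path_coloring G k C \<longleftrightarrow>
     C ` verts G \<subseteq> {1..k} \<and>
     (\<forall>p. vpath p G \<longrightarrow> (\<exists>c\<in>{1..k}. odd (card {v \<in> set p. C v = c})))"

definition ODD :: "('a, 'b) pre_digraph \<Rightarrow> nat" where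
  "ODD G = (LEAST k. \<exists>C. odd_path_coloring G k C)"

(* On finite graphs the minimum in ODD is over a nonempty set: use pairwise distinct colors. *)
lemma ODD_attained:
  assumes "finite (verts G)"
  shows "\<exists>C. odd_path_coloring G (ODD G) C"
proof -
  obtain C where C: "bij_betw C (verts G) {1..card (verts G)}"
    using finite_same_card_bij[OF assms, of "{1..card (verts G)}"] by auto
  have "odd_path_coloring G (card (verts G)) C"
    unfolding odd_path_coloring_def
  proof (intro conjI allI impI)
    show "C ` verts G \<subseteq> {1..card (verts G)}"
      using C by (simp add: bij_betw_def)
  next
    fix p assume "vpath p G"
    then have p: "set p \<subseteq> verts G" "p \<noteq> []" by (auto simp: vpath_def vwalk_def)
    then have hd: "hd p \<in> set p" by simp
    have "{v \<in> set p. C v = C (hd p)} = {hd p}"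
      using p(1) hd C unfolding bij_betw_def inj_on_def by blast
    moreover have "C (hd p) \<in> {1..card (verts G)}"
      using p(1) hd C unfolding bij_betw_def by blast
    ultimately show "\<exists>c\<in>{1..card (verts G)}. odd (card {v \<in> set p. C v = c})"
      by (intro bexI[of _ "C (hd p)"]) auto
  qed
  then have "\<exists>C. odd_path_coloring G (card (verts G)) C" by blast
  then show ?thesis unfolding ODD_def by (rule LeastI)
qed

lemma card_complete_binary_tree:
  "finite (pverts (complete_binary_tree d)) \<and> card (pverts (complete_binary_tree d)) = 2 ^ d - 1"
proof (induction d)
  case 0
  then show ?case by (simp add: complete_binary_tree_def)
next
  case (Suc d)
  have eq: "pverts (complete_binary_tree (Suc d)) =
      pverts (complete_binary_tree d) \<union> {xs. set xs \<subseteq> (UNIV :: bool set) \<and> length xs = d}"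
    by (auto simp: complete_binary_tree_def)
  have fin: "finite {xs. set xs \<subseteq> (UNIV :: bool set) \<and> length xs = d}"
    by (rule finite_lists_length_eq) simp
  have "card {xs. set xs \<subseteq> (UNIV :: bool set) \<and> length xs = d} = 2 ^ d"
    by (subst card_lists_length_eq) auto
  moreover have "pverts (complete_binary_tree d)
      \<inter> {xs. set xs \<subseteq> (UNIV :: bool set) \<and> length xs = d} = {}"
    by (auto simp: complete_binary_tree_def)
  ultimately show ?case
    unfolding eq using Suc fin by (simp add: card_Un_disjoint del: subset_UNIV)
qed

lemma pair_graph_complete_binary_tree: "pair_graph (complete_binary_tree d)"
proof -
  let ?T = "complete_binary_tree d"
  have sub: "parcs ?T \<subseteq> pverts ?T \<times> pverts ?T"
    by (auto simp: complete_binary_tree_def)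
  have fin: "finite (pverts ?T)" using card_complete_binary_tree by blast
  then have "finite (parcs ?T)" using sub by (meson finite_SigmaI finite_subset)
  with sub fin show ?thesis
    by unfold_locales (auto simp: complete_binary_tree_def symmetric_def sym_def)
qed

end

theory Submission
  imports Defs "HOL-Library.Tree"
begin

text \<open>
  Call the Strahler number of a rooted binary tree the height of the largest complete binary tree
  it contains topologically; subdividing edges does not decrease it, so it is at least \<open>d\<close>
  for \<open>B\<^sup>*\<close>. Restricting the branching vertices to one color \<open>c\<close> gives a number
  \<open>h c\<close>, and a Ramsey-type induction shows that these numbers add up to at least the Strahler
  number. It remains to see \<open>h c \<le> k\<close>. Let \<open>x\<close> and \<open>y\<close> be two branching vertices
  of color \<open>c\<close> that branch off at a vertex \<open>z\<close> of color \<open>c\<close>. The path from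
  \<open>x\<close> via \<open>z\<close> to the parent of \<open>y\<close> is not even in every color, and since the two
  vertices \<open>y\<close> (missing) and \<open>z\<close> (shared) have the same color, this says precisely that
  the root paths of \<open>x\<close> and \<open>y\<close> have different parity vectors. As there are at least
  \<open>2 ^ h c - 1\<close> such vertices and \<open>2 ^ k - 1\<close> nonzero parity vectors, \<open>h c \<le> k\<close>.
\<close>

section \<open>Strahler numbers and their distribution over the colors\<close>

fun strahler :: "'a tree \<Rightarrow> nat" where
  "strahler Leaf = 0"
| "strahler (Node l a r) =
     max (strahler l) (max (strahler r) (1 + min (strahler l) (strahler r)))"

fun color_strahler :: "('a \<Rightarrow> 'c) \<Rightarrow> 'c \<Rightarrow> 'a tree \<Rightarrow> nat" where
  "color_strahler C c Leaf = 0"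
| "color_strahler C c (Node l a r) =
     max (color_strahler C c l) (max (color_strahler C c r)
       (if C a = c then 1 + min (color_strahler C c l) (color_strahler C c r) else 0))"

lemma strahler_le_sum_color_strahler:
  assumes "finite K" "C ` set_tree t \<subseteq> K"
  shows "strahler t \<le> (\<Sum>c\<in>K. color_strahler C c t)"
  using assms(2)
proof (induction t)
  case (Node l a r)
  let ?f = "\<lambda>c. color_strahler C c l" and ?g = "\<lambda>c. color_strahler C c r"
    and ?h = "\<lambda>c. color_strahler C c (Node l a r)"
  have l: "strahler l \<le> sum ?f K" and r: "strahler r \<le> sum ?g K" and a: "C a \<in> K"
    using Node by auto
  have fh: "sum ?f K \<le> sum ?h K" and gh: "sum ?g K \<le> sum ?h K"
    by (auto intro!: sum_mono)
  have "1 + min (strahler l) (strahler r) \<le> sum ?h K"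
  \<comment> \<open>Otherwise both children's sums already equal the sum at the node. As every
    summand is monotone, equality holds color by color, but at color \<open>C a\<close> the node
    exceeds the smaller child by one.\<close>
  proof (rule ccontr)
    assume "\<not> ?thesis"
    then have "sum ?f K = sum ?h K" and "sum ?g K = sum ?h K"
      using l r fh gh by linarith+
    have "?f (C a) = ?h (C a)"
      using \<open>sum ?f K = sum ?h K\<close> _ a assms(1) by (rule sum_mono_inv) simp
    moreover have "?g (C a) = ?h (C a)"
      using \<open>sum ?g K = sum ?h K\<close> _ a assms(1) by (rule sum_mono_inv) simp
    moreover have "1 + min (?f (C a)) (?g (C a)) \<le> ?h (C a)" by simp
    ultimately show False by linarith
  qed
  then show ?case
    using l r fh gh by simp
qed simp

section \<open>Binary trees inside a graph, and subdivision of edges\<close>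

definition edge_to_root :: "'a pair_pre_digraph \<Rightarrow> 'a \<Rightarrow> 'a tree \<Rightarrow> bool" where
  "edge_to_root G p t \<longleftrightarrow> (case t of Leaf \<Rightarrow> True | Node _ a _ \<Rightarrow> (p, a) \<in> parcs G)"

lemma edge_to_root_simps [simp]:
  "edge_to_root G p Leaf"
  "edge_to_root G p (Node l a r) \<longleftrightarrow> (p, a) \<in> parcs G"
  by (simp_all add: edge_to_root_def)

text \<open>A node with a single \<open>Leaf\<close> child can stand for a subdividing vertex, so
  topological containment is expressed without explicit paths.\<close>

fun embedded :: "'a pair_pre_digraph \<Rightarrow> 'a tree \<Rightarrow> bool" where
  "embedded G Leaf \<longleftrightarrow> True"
| "embedded G (Node l a r) \<longleftrightarrow>
     a \<in> pverts G \<and> a \<notin> set_tree l \<and> a \<notin> set_tree r \<and> set_tree l \<inter> set_tree r = {} \<and>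
     edge_to_root G a l \<and> edge_to_root G a r \<and> embedded G l \<and> embedded G r"

lemma embedded_subset: "embedded G t \<Longrightarrow> set_tree t \<subseteq> pverts G"
  by (induction t) auto

text \<open>The argument \<open>p\<close> is the parent of the root, so that the edge into the root can be subdivided.\<close>

fun subdivide_tree :: "'a \<Rightarrow> 'a \<Rightarrow> 'a \<Rightarrow> 'a \<Rightarrow> 'a tree \<Rightarrow> 'a tree" where
  "subdivide_tree u v w p Leaf = Leaf"
| "subdivide_tree u v w p (Node l a r) =
    (let t = Node (subdivide_tree u v w a l) a (subdivide_tree u v w a r)
     in if {p, a} = {u, v} then Node Leaf w t else t)"

lemma set_subdivide_tree: "set_tree (subdivide_tree u v w p t) \<subseteq> insert w (set_tree t)"
  by (induction t arbitrary: p) (auto simp: Let_def)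

text \<open>The recursion inserts \<open>w\<close> only where it meets both ends of the subdivided
  edge. This is what excludes a second copy of \<open>w\<close>.\<close>

lemma set_subdivide_tree_new:
  "w \<in> set_tree (subdivide_tree u v w p t) \<Longrightarrow> w \<notin> set_tree t \<Longrightarrow> {u, v} \<subseteq> insert p (set_tree t)"
  by (induction t arbitrary: p) (fastforce simp: Let_def split: if_splits)+

lemma strahler_subdivide_tree: "strahler t \<le> strahler (subdivide_tree u v w p t)"
proof (induction t arbitrary: p)
  case (Node l a r)
  from Node(1)[of a] Node(2)[of a] show ?case
    by (auto simp: Let_def)
qed simp

lemma embedded_subdivide_Node:
  fixes G :: "'a pair_pre_digraph" and u v w a :: 'a
  defines "H \<equiv> subdivide G (u, v) w" and "f \<equiv> subdivide_tree u v w a"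
  assumes "embedded G (Node l a r)" "w \<notin> pverts G" "u \<noteq> v"
    and "embedded H (f l)" "edge_to_root H a (f l)" "embedded H (f r)" "edge_to_root H a (f r)"
  shows "embedded H (Node (f l) a (f r))"
proof -
  have "w \<notin> set_tree (Node l a r)"
    using embedded_subset[OF assms(3)] assms(4) by blast
  then have w: "w \<notin> set_tree l" "w \<notin> set_tree r" "w \<noteq> a" by auto
  have sub: "set_tree (f l) \<subseteq> insert w (set_tree l)" "set_tree (f r) \<subseteq> insert w (set_tree r)"
    unfolding f_def by (rule set_subdivide_tree)+
  \<comment> \<open>Two copies would put \<open>u\<close> and \<open>v\<close> into both subtrees
    extended by \<open>a\<close>. These share only \<open>a\<close>, so the edge would be a
    loop.\<close>
  have "\<not> (w \<in> set_tree (f l) \<and> w \<in> set_tree (f r))"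
  proof
    assume "w \<in> set_tree (f l) \<and> w \<in> set_tree (f r)"
    then have "{u, v} \<subseteq> insert a (set_tree l)" "{u, v} \<subseteq> insert a (set_tree r)"
      unfolding f_def using set_subdivide_tree_new w by metis+
    moreover have "set_tree l \<inter> set_tree r = {}" using assms(3) by simp
    ultimately have "u = a" "v = a" by blast+
    then show False using assms(5) by simp
  qed
  moreover have "a \<notin> set_tree l" "a \<notin> set_tree r" "set_tree l \<inter> set_tree r = {}" "a \<in> pverts G"
    using assms(3) by simp_all
  ultimately have "a \<notin> set_tree (f l)" "a \<notin> set_tree (f r)" "set_tree (f l) \<inter> set_tree (f r) = {}"
    using sub w by blast+
  then show ?thesis
    using assms(6-) \<open>a \<in> pverts G\<close> by (simp add: H_def)
qed

lemma embedded_subdivide_tree: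
  assumes "embedded G t" "edge_to_root G p t" "p \<notin> set_tree t"
    and "w \<notin> pverts G" "u \<noteq> v"
  shows "embedded (subdivide G (u, v) w) (subdivide_tree u v w p t) \<and>
    edge_to_root (subdivide G (u, v) w) p (subdivide_tree u v w p t)"
  using assms(1-3)
proof (induction t arbitrary: p)
  case (Node l a r)
  let ?H = "subdivide G (u, v) w"
  let ?l = "subdivide_tree u v w a l" and ?r = "subdivide_tree u v w a r"
  have inner: "embedded ?H (Node ?l a ?r)"
    using Node assms(4,5) by (intro embedded_subdivide_Node) auto
  show ?case
  proof (cases "{p, a} = {u, v}")
    case True
    have "w \<notin> set_tree (Node l a r)"
      using embedded_subset[OF Node.prems(1)] assms(4) by blast
    \<comment> \<open>The end \<open>p\<close> of the subdivided edge lies outside the tree, so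
      \<open>w\<close> has not been inserted further down.\<close>
    moreover have "\<not> {u, v} \<subseteq> insert a (set_tree l)" "\<not> {u, v} \<subseteq> insert a (set_tree r)"
      using True Node.prems(3) assms(5) by (auto simp: doubleton_eq_iff)
    ultimately have "w \<notin> set_tree (Node ?l a ?r)"
      using set_subdivide_tree_new[of w u v a l] set_subdivide_tree_new[of w u v a r] by auto
    then show ?thesis
      using True inner by (auto simp: doubleton_eq_iff)
  next
    case False
    then show ?thesis
      using inner Node.prems by (auto simp: doubleton_eq_iff)
  qed
qed simp

lemma subdivision_embeds_tree:
  assumes "subdivision_pair T B" "embedded T t"
  shows "\<exists>t'. embedded B t' \<and> strahler t \<le> strahler t'"
  using assms(1)
proof (induction rule: subdivision_pair_induct)
  case base
  then show ?case using assms(2) by blast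
next
  case (divide e w H)
  obtain u v where e: "e = (u, v)" by (cases e)
  interpret H: pair_bidirected_digraph H
    using divide(3) by (rule bidirected_digraphI_subdivision)
  have uv: "u \<noteq> v"
    using divide(1) e by (auto dest: H.adj_not_same)
  obtain t' where t': "embedded H t'" "strahler t \<le> strahler t'"
    using divide by blast
  show ?case
  proof (cases t')
    case Leaf
    then show ?thesis using t' by (intro exI[of _ Leaf]) auto
  next
    case (Node l a r)
    \<comment> \<open>The topmost root has no parent edge, so its two subtrees are treated
      separately, with \<open>a\<close> as their parent.\<close>
    let ?f = "subdivide_tree u v w a"
    have "embedded (subdivide H e w) (?f s) \<and> edge_to_root (subdivide H e w) a (?f s)"
      if "s \<in> {l, r}" for s
      unfolding e using that t'(1) Node divide(2) uv by (intro embedded_subdivide_tree) auto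
    then have "embedded (subdivide H e w) (Node (?f l) a (?f r))"
      unfolding e using t'(1) Node divide(2) uv by (intro embedded_subdivide_Node) auto
    moreover have "strahler t' \<le> strahler (Node (?f l) a (?f r))"
      using Node strahler_subdivide_tree[of l u v w a] strahler_subdivide_tree[of r u v w a] by auto
    ultimately show ?thesis using t' by (meson order_trans)
  qed
qed

section \<open>The complete binary tree as an embedded tree\<close>

text \<open>Since the parent of a list is its tail, the descendants of \<open>xs\<close> are the
  lists with suffix \<open>xs\<close>; \<open>n\<close> counts the levels and \<open>f\<close> will
  be the isomorphism.\<close>

fun suffix_tree :: "(bool list \<Rightarrow> 'a) \<Rightarrow> nat \<Rightarrow> bool list \<Rightarrow> 'a tree" where
  "suffix_tree f 0 xs = Leaf"
| "suffix_tree f (Suc n) xs =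
     Node (suffix_tree f n (False # xs)) (f xs) (suffix_tree f n (True # xs))"

lemma set_suffix_tree:
  "set_tree (suffix_tree f n xs) \<subseteq> f ` {ys @ xs | ys. length ys < n}"
proof (induction n arbitrary: xs)
  case (Suc n)
  have "set_tree (suffix_tree f n (b # xs)) \<subseteq> f ` {ys @ xs | ys. length ys < Suc n}" for b
  proof -
    have "{ys @ b # xs | ys. length ys < n} \<subseteq> {ys @ xs | ys. length ys < Suc n}"
    proof safe
      fix ys :: "bool list" assume "length ys < n"
      then show "\<exists>zs. ys @ b # xs = zs @ xs \<and> length zs < Suc n"
        by (intro exI[of _ "ys @ [b]"]) simp
    qed
    then show ?thesis by (rule order_trans[OF Suc image_mono])
  qed
  moreover have "f xs \<in> f ` {ys @ xs | ys. length ys < Suc n}"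
    by (intro imageI) auto
  ultimately show ?case by simp
qed simp

lemma strahler_suffix_tree: "strahler (suffix_tree f n xs) = n"
  by (induction n arbitrary: xs) auto

lemma embedded_suffix_tree:
  assumes "inj_on f {xs. length xs < d}" "f ` {xs. length xs < d} \<subseteq> pverts G"
    and "\<And>b xs. length (b # xs) < d \<Longrightarrow> (f xs, f (b # xs)) \<in> parcs G"
    and "length xs + n \<le> d"
  shows "embedded G (suffix_tree f n xs)"
  using assms(4)
proof (induction n arbitrary: xs)
  case (Suc n)
  have sub: "set_tree (suffix_tree f n (b # xs)) \<subseteq> f ` {ys @ b # xs | ys. length ys < n}" for b
    by (rule set_suffix_tree)
  have notin: "f xs \<notin> set_tree (suffix_tree f n (b # xs))" for b
  proof
    assume "f xs \<in> set_tree (suffix_tree f n (b # xs))"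
    then obtain ys where "f xs = f (ys @ b # xs)" "length ys < n"
      using sub by blast
    with inj_onD[OF assms(1), of xs "ys @ b # xs"] Suc.prems show False by auto
  qed
  have disj: "set_tree (suffix_tree f n (False # xs)) \<inter> set_tree (suffix_tree f n (True # xs)) = {}"
  proof (rule equals0I, erule IntE)
    fix z
    assume "z \<in> set_tree (suffix_tree f n (False # xs))" "z \<in> set_tree (suffix_tree f n (True # xs))"
    then obtain ys zs where "z = f (ys @ False # xs)" "z = f (zs @ True # xs)"
      "length ys < n" "length zs < n"
      using sub[of False] sub[of True] by blast
    with inj_onD[OF assms(1), of "ys @ False # xs" "zs @ True # xs"] Suc.prems
    have "ys @ False # xs = zs @ True # xs" by simp
    \<comment> \<open>Stripping the common suffix \<open>xs\<close> leaves lists with different last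
      letters.\<close>
    then have "(ys @ [False]) @ xs = (zs @ [True]) @ xs" by simp
    then show False unfolding append_same_eq by simp
  qed
  have "edge_to_root G (f xs) (suffix_tree f n (b # xs))" for b
    using assms(3)[of b xs] Suc.prems by (cases n) auto
  moreover have "f xs \<in> pverts G"
    using assms(2) Suc.prems by auto
  ultimately show ?case
    using notin disj Suc by simp
qed simp

section \<open>Root paths and how to join them\<close>

fun root_paths :: "'a tree \<Rightarrow> 'a list set" where
  "root_paths Leaf = {}"
| "root_paths (Node l a r) = insert [a] ((#) a ` (root_paths l \<union> root_paths r))"

lemma root_paths_nonempty: "p \<in> root_paths t \<Longrightarrow> p \<noteq> []"
  by (cases t) auto

lemma set_root_paths: "p \<in> root_paths t \<Longrightarrow> set p \<subseteq> set_tree t"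
  by (induction t arbitrary: p) fastforce+

lemma finite_root_paths: "finite (root_paths t)"
  by (induction t) auto

lemma edge_to_root_path: "edge_to_root G a t \<Longrightarrow> p \<in> root_paths t \<Longrightarrow> (a, hd p) \<in> parcs G"
  by (cases t) auto

lemma vpath_Cons:
  assumes "vpath p G" "a \<in> verts G" "(a, hd p) \<in> arcs_ends G" "a \<notin> set p"
  shows "vpath (a # p) G"
  using assms by (auto simp: vpath_def intro: vwalk_consI)

lemma vpath_root_path: "embedded G t \<Longrightarrow> p \<in> root_paths t \<Longrightarrow> vpath p (with_proj G)"
proof (induction t arbitrary: p)
  case (Node l a r)
  have "vpath [a] (with_proj G)"
    using Node.prems by (auto simp: vpath_def vwalk_def)
  moreover have "vpath (a # q) (with_proj G)" if "q \<in> root_paths l \<union> root_paths r" for q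
    using that Node set_root_paths[of q l] set_root_paths[of q r]
    by (intro vpath_Cons) (auto dest: edge_to_root_path)
  ultimately show ?case using Node.prems by auto
qed simp

lemma vpath_join:
  assumes "sym (parcs G)" "vpath p (with_proj G)" "vpath q (with_proj G)"
    and "hd p = hd q" "set p \<inter> set (tl q) = {}"
  shows "vpath (rev p @ tl q) (with_proj G)"
proof (cases "tl q")
  case Nil
  then show ?thesis using assms
    by (auto simp: vpath_def vwalk_def set_vwalk_arcs_rev dest: symD)
next
  case (Cons y ys)
  then obtain x where q: "q = x # y # ys" by (cases q) auto
  have "set (vwalk_arcs (rev p)) \<subseteq> parcs G"
    using assms(1,2) by (auto simp: vpath_def vwalk_def set_vwalk_arcs_rev dest: symD)
  moreover have "p \<noteq> []" using assms(2) by (auto simp: vpath_def vwalk_def)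
  ultimately show ?thesis using assms q
    by (auto simp: vpath_def vwalk_def vwalk_arcs_append last_rev)
qed

lemma vpath_butlast:
  assumes "vpath p (with_proj G)" "butlast p \<noteq> []"
  shows "vpath (butlast p) (with_proj G)"
proof -
  have "p = butlast p @ [last p]"
    using assms(2) by (cases p rule: rev_cases) auto
  then have "set (vwalk_arcs (butlast p)) \<subseteq> set (vwalk_arcs p)"
    by (metis set_vwalk_arcs_append1)
  then show ?thesis
    using assms by (auto simp: vpath_def vwalk_def distinct_butlast dest: in_set_butlastD)
qed

section \<open>Parity vectors and the bound for a single color\<close>

text \<open>A vector over GF(2), given by its support. Counting with multiplicity turns appending
  into symmetric difference for arbitrary lists.\<close>

definition parity :: "('a \<Rightarrow> 'c) \<Rightarrow> 'a list \<Rightarrow> 'c set" where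
  "parity C p = {c. odd (count_list (map C p) c)}"

lemma parity_simps [simp]:
  "parity C [] = {}"
  "c \<in> parity C (x # p) \<longleftrightarrow> (c = C x) \<noteq> (c \<in> parity C p)"
  "c \<in> parity C (p @ q) \<longleftrightarrow> (c \<in> parity C p) \<noteq> (c \<in> parity C q)"
  "parity C (rev p) = parity C p"
  by (auto simp: parity_def simp flip: rev_map)

lemma parity_subset: "parity C p \<subseteq> C ` set p"
proof
  fix c assume "c \<in> parity C p"
  then have "count_list (map C p) c \<noteq> 0"
    unfolding parity_def by (metis even_zero mem_Collect_eq)
  then show "c \<in> C ` set p" by (metis count_notin set_map)
qed

lemma count_list_map_distinct:
  assumes "distinct p"
  shows "count_list (map C p) c = card {v \<in> set p. C v = c}"
proof -
  have "count_list (map C p) c = length (filter (\<lambda>v. C v = c) p)"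
    by (induction p) auto
  then show ?thesis
    using assms distinct_card[of "filter (\<lambda>v. C v = c) p"] by simp
qed

text \<open>The path avoids the last vertex of \<open>q\<close>, whose color cancels that of \<open>a\<close>.\<close>

lemma parity_across_branch:
  assumes "sym (parcs G)" "embedded G (Node l a r)"
    and odd: "\<And>p. vpath p (with_proj G) \<Longrightarrow> parity C p \<noteq> {}"
    and p: "p \<in> root_paths l" and q: "q \<in> root_paths r" and last: "C (last q) = C a"
  shows "parity C p \<noteq> parity C q"
proof -
  have ap: "vpath (a # p) (with_proj G)" and aq: "vpath (a # q) (with_proj G)"
    using assms(2) p q by (auto intro!: vpath_root_path[of G "Node l a r"])
  have ne: "q \<noteq> []" using q by (rule root_paths_nonempty)
  then have abq: "vpath (a # butlast q) (with_proj G)"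
    using vpath_butlast[OF aq] by simp
  have "set (a # p) \<inter> set (butlast q) = {}"
    using set_root_paths[OF p] set_root_paths[OF q] assms(2) by (auto dest!: in_set_butlastD)
  then have "vpath (rev (a # p) @ butlast q) (with_proj G)"
    using vpath_join[OF assms(1) ap abq] by simp
  then have *: "parity C (rev (a # p) @ butlast q) \<noteq> {}"
    by (rule odd)
  have "c \<in> parity C q \<longleftrightarrow> (c \<in> parity C (butlast q)) \<noteq> (c = C a)" for c
    using parity_simps(3)[of c C "butlast q" "[last q]"] ne last by simp
  with * show ?thesis
    by (auto simp del: rev.simps(2))
qed

text \<open>A vertex is represented by its root path. At a branching node of color \<open>c\<close>
  both families survive together and \<open>[a]\<close> joins them, so \<open>card U + 1\<close>
  adds up over the children.\<close>

lemma color_strahler_paths: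
  assumes "sym (parcs G)" and odd: "\<And>p. vpath p (with_proj G) \<Longrightarrow> parity C p \<noteq> {}"
    and "embedded G t"
  shows "\<exists>U \<subseteq> root_paths t. 2 ^ color_strahler C c t \<le> card U + 1 \<and>
    (\<forall>p\<in>U. C (last p) = c) \<and> inj_on (parity C) U"
  using assms(3)
proof (induction t)
  case Leaf
  then show ?case by auto
next
  case (Node l a r)
  obtain L where L: "L \<subseteq> root_paths l" "2 ^ color_strahler C c l \<le> card L + 1"
    "\<forall>p\<in>L. C (last p) = c" "inj_on (parity C) L"
    using Node by auto
  obtain R where R: "R \<subseteq> root_paths r" "2 ^ color_strahler C c r \<le> card R + 1"
    "\<forall>p\<in>R. C (last p) = c" "inj_on (parity C) R"
    using Node by auto
  have fin: "finite L" "finite R"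
    using L R finite_root_paths finite_subset by blast+
  have ne: "p \<noteq> []" if "p \<in> L \<union> R" for p
    using that L R root_paths_nonempty by blast
  \<comment> \<open>Prefixing \<open>a\<close> flips the same coordinate in every vector.\<close>
  have Cons_eq: "parity C (a # p) = parity C (a # q) \<longleftrightarrow> parity C p = parity C q" for p q
    by (auto simp: set_eq_iff)
  have Cons_card: "card ((#) a ` X) = card X" for X
    by (simp add: card_image)
  let ?h = "color_strahler C c (Node l a r)"
  have "?h = color_strahler C c l \<or> ?h = color_strahler C c r \<or>
      C a = c \<and> ?h = 1 + min (color_strahler C c l) (color_strahler C c r)"
    by (simp add: max_def)
  then consider "?h = color_strahler C c l" | "?h = color_strahler C c r"
    | "C a = c" "?h = 1 + min (color_strahler C c l) (color_strahler C c r)"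
    by blast
  then show ?case
  proof cases
    case 1
    then show ?thesis using L ne
      by (intro exI[of _ "(#) a ` L"]) (auto simp: Cons_card inj_on_def Cons_eq)
  next
    case 2
    then show ?thesis using R ne
      by (intro exI[of _ "(#) a ` R"]) (auto simp: Cons_card inj_on_def Cons_eq)
  next
    case 3
    let ?U = "insert [a] ((#) a ` (L \<union> R))"
    have LR: "parity C p \<noteq> parity C q" if "p \<in> L" "q \<in> R" for p q
      using that L R 3 by (intro parity_across_branch[OF assms(1) Node.prems odd]) auto
    then have "L \<inter> R = {}" by auto
    moreover have "[a] \<notin> (#) a ` (L \<union> R)" using ne by auto
    ultimately have "card ?U = card L + card R + 1"
      using fin by (simp add: Cons_card card_Un_disjoint del: image_Un)
    moreover have "2 ^ ?h \<le> (2::nat) ^ color_strahler C c l + 2 ^ color_strahler C c r"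
      unfolding 3(2) by (simp add: min_def)
    ultimately have "2 ^ ?h \<le> card ?U + 1"
      using L(2) R(2) by linarith
    moreover have "inj_on (parity C) ?U"
    proof -
      have "parity C p \<noteq> {}" if "p \<in> L \<union> R" for p
        using that L R Node.prems by (intro odd) (auto intro: vpath_root_path)
      \<comment> \<open>Cancelling \<open>a\<close> leaves the empty vector against that of the path
        \<open>p\<close>, which is nonzero.\<close>
      then have "parity C [a] \<noteq> parity C (a # p)" if "p \<in> L \<union> R" for p
        using that Cons_eq[of "[]" p] by auto
      moreover have "inj_on (parity C) (L \<union> R)"
        using L(4) R(4) LR by (auto simp: inj_on_Un)
      ultimately show ?thesis
        unfolding inj_on_insert by (auto simp: inj_on_def Cons_eq simp del: parity_simps)
    qed
    ultimately show ?thesis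
      using L R ne 3 by (intro exI[of _ ?U]) auto
  qed
qed

lemma color_strahler_le:
  assumes "sym (parcs G)" and odd: "\<And>p. vpath p (with_proj G) \<Longrightarrow> parity C p \<noteq> {}"
    and "embedded G t" and K: "C ` pverts G \<subseteq> K" "finite K"
  shows "color_strahler C c t \<le> card K"
proof -
  obtain U where U: "U \<subseteq> root_paths t" "2 ^ color_strahler C c t \<le> card U + 1"
    "inj_on (parity C) U"
    using color_strahler_paths[OF assms(1-3)] by metis
  have "parity C p \<in> Pow K - {{}}" if "p \<in> U" for p
  proof -
    have "p \<in> root_paths t" using that U(1) by blast
    then have "set p \<subseteq> pverts G" "parity C p \<noteq> {}"
      using set_root_paths embedded_subset[OF assms(3)] odd vpath_root_path[OF assms(3)] by blast+
    then show ?thesis using K(1) parity_subset[of C p] by blast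
  qed
  \<comment> \<open>Pigeonhole: the vectors are distinct nonempty subsets of
    \<open>K\<close>.\<close>
  then have "card U \<le> card (Pow K - {{}})"
    using U(3) K(2) by (intro card_inj_on_le[of "parity C"]) auto
  also have "\<dots> = 2 ^ card K - 1"
    using K(2) by (simp add: card_Pow)
  finally have "2 ^ color_strahler C c t \<le> (2::nat) ^ card K"
    using U(2) zero_less_power[of "2::nat" "card K"] by linarith
  then show ?thesis by simp
qed

section \<open>Transfer to the given subdivision and the final count\<close>

lemma complete_binary_tree_embeds:
  assumes "digraph_iso (with_proj (complete_binary_tree d)) (with_proj T)"
  shows "finite (pverts T) \<and> (\<exists>t. embedded T t \<and> strahler t = d)"
proof -
  let ?B = "with_proj (complete_binary_tree d)"
  obtain h where h: "pre_digraph.digraph_isomorphism ?B h" "with_proj T = app_iso h ?B"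
    using assms by (auto simp: digraph_iso_def)
  let ?f = "iso_verts h"
  have V: "pverts T = ?f ` {xs. length xs < d}"
    using arg_cong[OF h(2), of verts] by (simp add: complete_binary_tree_def)
  have A: "parcs T = iso_arcs h ` parcs (complete_binary_tree d)"
    using arg_cong[OF h(2), of arcs] by simp
  \<comment> \<open>Arcs of \<open>T\<close> are pairs, so \<open>h\<close> must send an arc to the
    pair of images of its ends.\<close>
  have ends: "fst = iso_tail h" "snd = iso_head h"
    using arg_cong[OF h(2), of tail] arg_cong[OF h(2), of head] by simp_all
  have inj: "inj_on ?f {xs. length xs < d}"
    using h(1) by (auto simp: pre_digraph.digraph_isomorphism_def complete_binary_tree_def)
  have E: "(?f xs, ?f (b # xs)) \<in> parcs T" if "length (b # xs) < d" for b xs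
  proof -
    have arc: "(xs, b # xs) \<in> parcs (complete_binary_tree d)"
      using that by (auto simp: complete_binary_tree_def)
    then have "iso_arcs h (xs, b # xs) = (?f xs, ?f (b # xs))"
      using h(1) by (auto simp: pre_digraph.digraph_isomorphism_def prod_eq_iff simp flip: ends)
    then show ?thesis using arc A by (metis imageI)
  qed
  have "finite {xs :: bool list. length xs < d}"
    using card_complete_binary_tree[of d] by (simp add: complete_binary_tree_def)
  then have "finite (pverts T)" unfolding V by simp
  then show ?thesis
    using embedded_suffix_tree[OF inj _ E, where n = d and xs = "[]"] strahler_suffix_tree V
    by (intro conjI exI[of _ "suffix_tree ?f d []"]) auto
qed

text \<open>Makes \<open>ODD_attained\<close> applicable to the subdivided tree.\<close>

lemma finite_subdivision_pair:
  assumes "subdivision_pair T B" "finite (pverts T)"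
  shows "finite (pverts B)"
  using assms(1) by (induction rule: subdivision_pair_induct) (simp_all add: assms(2))

theorem theorem3:
  fixes d :: nat and T B :: "'a pair_pre_digraph"
  assumes "d \<ge> 1"
    and "digraph_iso (with_proj (complete_binary_tree d)) (with_proj T)"
    and "subdivision_pair T B"
  shows "real (ODD (with_proj B)) \<ge> sqrt (real d)"
proof -
  define k where "k = ODD (with_proj B)"
  interpret B: pair_bidirected_digraph B
    using assms(3) by (rule bidirected_digraphI_subdivision)
  have sym: "sym (parcs B)"
    by (auto intro: symI B.arcs_symmetric)
  obtain t where t: "embedded B t" "d \<le> strahler t"
    using complete_binary_tree_embeds[OF assms(2)] subdivision_embeds_tree[OF assms(3)] by metis
  have "finite (pverts B)"
    using complete_binary_tree_embeds[OF assms(2)] finite_subdivision_pair[OF assms(3)] by blast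
  then obtain C where C: "odd_path_coloring (with_proj B) k C"
    unfolding k_def using ODD_attained[of "with_proj B"] by auto
  have K: "C ` pverts B \<subseteq> {1..k}"
    using C by (simp add: odd_path_coloring_def)
  \<comment> \<open>Paths are repetition-free, so counting with multiplicity agrees with the
    cardinalities in the coloring condition.\<close>
  have odd: "parity C p \<noteq> {}" if "vpath p (with_proj B)" for p
  proof -
    have "\<exists>c\<in>{1..k}. odd (card {v \<in> set p. C v = c})"
      using C that by (simp add: odd_path_coloring_def)
    then obtain c where "odd (card {v \<in> set p. C v = c})" by (rule bexE)
    moreover have "distinct p" using that by (simp add: vpath_def)
    ultimately have "c \<in> parity C p" by (simp add: parity_def count_list_map_distinct)
    then show ?thesis by blast
  qed
  \<comment> \<open>There are \<open>k\<close> colors, and each contributes at most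
    \<open>k\<close>.\<close>
  have "d \<le> strahler t" by (rule t)
  also have "\<dots> \<le> (\<Sum>c\<in>{1..k}. color_strahler C c t)"
    using K embedded_subset[OF t(1)] by (intro strahler_le_sum_color_strahler) auto
  also have "\<dots> \<le> (\<Sum>c\<in>{1..k}. k)"
    using color_strahler_le[OF sym odd t(1) K] by (intro sum_mono) simp
  finally have "d \<le> k\<^sup>2" by (simp add: power2_eq_square)
  then have "real d \<le> (real k)\<^sup>2"
    by (metis of_nat_le_iff of_nat_power)
  then show ?thesis
    unfolding k_def[symmetric] by (simp add: real_le_lsqrt)
qed

end
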